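(* Suppose $\{(X_i,Y_i)\}_{i=1}^n$ are i.i.d. observations from $Y=m_0(\theta_0^\top X)+\epsilon$ such that: the convex link function $m_0$ is bounded in absolute value by a constant $M_0\ge1$ on $D$ and Lipschitz on $D$ with constant $L_0$; $\sup_{x\in\chi}|x|\le T<\infty$; $\epsilon$ has finite $q$th moment for some $q\ge2$, $\mathbb{E}(\epsilon\mid X)=0$ and $\mathbb{E}(\epsilon^2\mid X=x)\le \sigma^2$ for all $x\in\chi$; and $\theta_0^\top X\sim\mathrm{Uniform}[0,1]$. Moreover, suppose the errors are independent of the covariates and $\epsilon\sim N(0,\sigma^2)$ for some $\sigma>0$. Then there exist positive constants $k_1,k_2$, depending only on $\sigma$ and $L_0$, such that $$\inf_{\hat f}\ \sup_{(m_0,\theta_0)\in\mathcal{M}_{L_0}\times\Theta}\mathbb{P}\left(n^{2/5}\,\|\hat f-m_0\circ\theta_0\|>k_1\right)\ge k_2>0,$$ where the infimum is over all estimators $\hat f$ of $m_0\circ\theta_0$ based on $\{(X_i,Y_i)\}_{i=1}^n$.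
   Context: $X\in\mathbb{R}^d$ has law $P_X$ and support $\chi$; $|\cdot|$ is the Euclidean norm; $\Theta=\{\eta\in\mathbb{R}^d:|\eta|=1,\ \eta_1\ge0\}$; $D=\mathrm{conv}\{\theta^\top x:x\in\chi,\theta\in\Theta\}$. $\mathcal{M}_{L_0}$ is the class of convex functions $m:D\to\mathbb{R}$ that are Lipschitz with constant $L_0$. $(m\circ\theta)(x)=m(\theta^\top x)$. For $g:\chi\to\mathbb{R}$, $\|g\|^2=\int g^2\,dP_X$ (for random $g$, integration is over $x\sim P_X$ only). $\mathbb{P}$ is the probability when the data are generated from the model with parameters $(m_0,\theta_0)$. *)

theory Defs
  imports "HOL-Probability.Probability"
begin

(* The constants of the theorem must not depend on the dimension d, so d is quantified inside
   the statement: points of R^d are functions on {..<d}, extended by undefined. *)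

definition vec_space :: "nat \<Rightarrow> (nat \<Rightarrow> real) measure" where
  "vec_space d = (\<Pi>\<^sub>M i\<in>{..<d}. borel)"

definition inner_d :: "nat \<Rightarrow> (nat \<Rightarrow> real) \<Rightarrow> (nat \<Rightarrow> real) \<Rightarrow> real" where
  "inner_d d \<theta> x = (\<Sum>i<d. \<theta> i * x i)"

definition norm_d :: "nat \<Rightarrow> (nat \<Rightarrow> real) \<Rightarrow> real" where
  "norm_d d x = L2_set x {..<d}"

definition support_d :: "nat \<Rightarrow> (nat \<Rightarrow> real) measure \<Rightarrow> (nat \<Rightarrow> real) set" where
  "support_d d P = {x \<in> space (vec_space d).
     \<forall>r>0. emeasure P {y \<in> space (vec_space d). norm_d d (\<lambda>i. y i - x i) < r} > 0}"

(* The first coordinate has index 0. *)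
definition Theta :: "nat \<Rightarrow> (nat \<Rightarrow> real) set" where
  "Theta d = {\<eta> \<in> space (vec_space d). norm_d d \<eta> = 1 \<and> 0 \<le> \<eta> 0}"

definition index_domain :: "nat \<Rightarrow> (nat \<Rightarrow> real) set \<Rightarrow> real set" where
  "index_domain d S = convex hull {inner_d d \<theta> x |\<theta> x. x \<in> S \<and> \<theta> \<in> Theta d}"

(* A function D -> R is extended by undefined outside D, which keeps it Borel measurable. *)
definition link_class :: "real \<Rightarrow> real set \<Rightarrow> (real \<Rightarrow> real) set" where
  "link_class L D = {m \<in> extensional D. convex_on D m \<and> L-lipschitz_on D m}"

(* Q is the joint law of (X, \<epsilon>); the result is the law of n i.i.d. copies of (X, Y). *)
definition sample_law ::
    "nat \<Rightarrow> nat \<Rightarrow> ((nat \<Rightarrow> real) \<times> real) measure \<Rightarrow> (real \<Rightarrow> real) \<Rightarrow> (nat \<Rightarrow> real)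
      \<Rightarrow> (nat \<Rightarrow> (nat \<Rightarrow> real) \<times> real) measure" where
  "sample_law n d Q m \<theta> = (\<Pi>\<^sub>M i\<in>{..<n}.
     distr Q (vec_space d \<Otimes>\<^sub>M borel) (\<lambda>(x, e). (x, m (inner_d d \<theta> x) + e)))"

definition estimators ::
    "nat \<Rightarrow> nat \<Rightarrow> ((nat \<Rightarrow> (nat \<Rightarrow> real) \<times> real) \<Rightarrow> (nat \<Rightarrow> real) \<Rightarrow> real) set" where
  "estimators n d = {f. case_prod f \<in> borel_measurable
     ((\<Pi>\<^sub>M i\<in>{..<n}. vec_space d \<Otimes>\<^sub>M borel) \<Otimes>\<^sub>M vec_space d)}"

(* Extended-valued, because an estimate need not be square integrable: a Bochner integral would
   give such an estimate the norm 0. *)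
definition L2_norm_on :: "'a measure \<Rightarrow> 'a set \<Rightarrow> ('a \<Rightarrow> real) \<Rightarrow> ennreal" where
  "L2_norm_on P A g = (let I = (\<integral>\<^sup>+x\<in>A. ennreal ((g x)\<^sup>2) \<partial>P)
     in if I = \<infinity> then \<infinity> else ennreal (sqrt (enn2real I)))"

end

theory Submission
  imports Defs
begin

text \<open>
  The direction stays fixed at its true value, and only the link varies. Cut [0, 1] into J cells, J about
  n^(1/5). A sum of J hinges, one at the middle of each cell, is convex, and stays so when in an arbitrary
  set v of cells the hinge is replaced by the average of two hinges at the end points of the cell. A
  replacement changes the link by a tent of height of order J^(-2) on that cell only. With n observations
  two links that differ in one cell have bounded chi-square divergence, so no test finds out reliably
  whether that cell was changed. By Assouad's argument some v forces, with probability at least 1/8, a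
  wrong decision in at least J/8 cells. Applied to the tests that compare the distances of an estimate to
  the two candidate links cell by cell, this says that the squared loss is at least of order
  J * J^(-5) = J^(-4), that is, n^(-4/5).
\<close>

subsection \<open>Testing between Gaussian regressions\<close>

text \<open>Both sides agree on boxes, where the integral of a product factorizes over the
  coordinates, and boxes determine a measure on a finite product. This turns the likelihood ratio of
  one observation into that of a whole sample.\<close>

lemma PiM_density:
  fixes I :: "'i set"
  assumes fin: "finite I" and M: "prob_space M" and L[measurable]: "L \<in> borel_measurable M"
    and N: "prob_space (density M L)"
  shows "(\<Pi>\<^sub>M i\<in>I. density M L) = density (\<Pi>\<^sub>M i\<in>I. M) (\<lambda>\<omega>. \<Prod>i\<in>I. L (\<omega> i))"
proof -
  interpret M: product_sigma_finite "\<lambda>_::'i. M"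
    using M by (simp add: product_sigma_finite_def prob_space_imp_sigma_finite)
  interpret N: product_sigma_finite "\<lambda>_::'i. density M L"
    using N by (simp add: product_sigma_finite_def prob_space_imp_sigma_finite)
  have [measurable]: "(\<lambda>\<omega>. \<Prod>i\<in>I. L (\<omega> i)) \<in> borel_measurable (\<Pi>\<^sub>M i\<in>I. M)"
    by (intro borel_measurable_prod_ennreal measurable_compose[OF _ L] measurable_component_singleton)
  show ?thesis
  proof (rule N.PiM_eqI[OF fin, symmetric])
    show "sets (density (\<Pi>\<^sub>M i\<in>I. M) (\<lambda>\<omega>. \<Prod>i\<in>I. L (\<omega> i))) = sets (\<Pi>\<^sub>M i\<in>I. density M L)"
      by (simp cong: sets_PiM_cong)
  next
    fix A assume A: "\<And>i. i \<in> I \<Longrightarrow> A i \<in> sets (density M L)"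
    then have [measurable]: "Pi\<^sub>E I A \<in> sets (\<Pi>\<^sub>M i\<in>I. M)"
      using fin by (intro sets_PiM_I_finite) auto
    have ind: "(\<Prod>i\<in>I. indicator (A i) (\<omega> i)) = (indicator (Pi\<^sub>E I A) \<omega> :: ennreal)"
      if "\<omega> \<in> space (\<Pi>\<^sub>M i\<in>I. M)" for \<omega>
      using that fin by (auto simp: space_PiM PiE_iff indicator_def prod_zero_iff)
    have "emeasure (density (\<Pi>\<^sub>M i\<in>I. M) (\<lambda>\<omega>. \<Prod>i\<in>I. L (\<omega> i))) (Pi\<^sub>E I A)
      = (\<integral>\<^sup>+\<omega>. (\<Prod>i\<in>I. L (\<omega> i)) * indicator (Pi\<^sub>E I A) \<omega> \<partial>(\<Pi>\<^sub>M i\<in>I. M))"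
      by (rule emeasure_density) auto
    also have "\<dots> = (\<integral>\<^sup>+\<omega>. (\<Prod>i\<in>I. L (\<omega> i) * indicator (A i) (\<omega> i)) \<partial>(\<Pi>\<^sub>M i\<in>I. M))"
      by (intro nn_integral_cong) (simp add: prod.distrib ind)
    also have "\<dots> = (\<Prod>i\<in>I. \<integral>\<^sup>+x. L x * indicator (A i) x \<partial>M)"
      using A fin by (intro M.product_nn_integral_prod) auto
    also have "\<dots> = (\<Prod>i\<in>I. emeasure (density M L) (A i))"
      using A by (intro prod.cong refl) (auto simp: emeasure_density)
    finally show "emeasure (density (\<Pi>\<^sub>M i\<in>I. M) (\<lambda>\<omega>. \<Prod>i\<in>I. L (\<omega> i))) (Pi\<^sub>E I A)
      = (\<Prod>i\<in>I. emeasure (density M L) (A i))" .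
  qed
qed

text \<open>Le Cam's bound for two hypotheses: \<open>A\<close> rejects \<open>M\<close>, so the sum
  is that of the two error probabilities. The second moment of \<open>L\<close> is one plus the
  chi-square divergence. Of the total mass 1 of \<open>L\<close>, the quadratic term takes away at
  most 2/4.\<close>

lemma two_point_testing:
  assumes M: "prob_space M" and L[measurable]: "L \<in> borel_measurable M"
    and N: "prob_space (density M L)" and A[measurable]: "A \<in> sets M"
    and chi: "(\<integral>\<^sup>+x. (L x)\<^sup>2 \<partial>M) \<le> 2"
  shows "1/2 \<le> measure M A + measure (density M L) (space M - A)"
proof -
  interpret M: prob_space M by fact
  interpret N: prob_space "density M L" by fact
  \<comment> \<open>Amounts to \<open>l - l\<^sup>2/4 \<le> min 1 l\<close>, and the sum of the two errors is at least the integral of \<open>min 1 L\<close>.\<close>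
  have pt: "l \<le> 1 + ennreal (1/4) * l\<^sup>2" for l :: ennreal
  proof (cases l)
    case (real r)
    have "0 \<le> (1 - r/2)\<^sup>2" by simp
    then have "r \<le> 1 + (1/4) * r\<^sup>2" by (simp add: power2_eq_square algebra_simps)
    then have "ennreal r \<le> ennreal 1 + ennreal (1/4) * ennreal r ^ 2"
      using real by (simp add: ennreal_plus[symmetric] ennreal_mult[symmetric] ennreal_power del: ennreal_plus ennreal_1)
    then show ?thesis using real by simp
  qed (simp add: ennreal_mult_top power2_eq_square)
  have "1 = (\<integral>\<^sup>+x. L x \<partial>M)"
    using N.emeasure_space_1 by (simp add: emeasure_density cong: nn_integral_cong_simp)
  also have "\<dots> \<le> (\<integral>\<^sup>+x. indicator A x + L x * indicator (space M - A) x + ennreal (1/4) * (L x)\<^sup>2 \<partial>M)"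
    using pt by (intro nn_integral_mono) (auto simp: indicator_def)
  also have "\<dots> = emeasure M A + emeasure (density M L) (space M - A) + ennreal (1/4) * (\<integral>\<^sup>+x. (L x)\<^sup>2 \<partial>M)"
    by (simp add: nn_integral_add nn_integral_cmult emeasure_density)
  also have "\<dots> \<le> emeasure M A + emeasure (density M L) (space M - A) + ennreal (1/4) * 2"
    by (intro add_mono mult_left_mono chi) auto
  also have "ennreal (1/4) * 2 = ennreal (1/2)"
    unfolding ennreal_numeral[symmetric] by (subst ennreal_mult[symmetric]) auto
  finally have "ennreal 1 \<le> ennreal (measure M A + measure (density M L) (space M - A) + 1/2)"
    unfolding M.emeasure_eq_measure N.emeasure_eq_measure
    by (subst ennreal_plus, simp, simp, subst ennreal_plus) (simp_all only: measure_nonneg ennreal_1)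
  then have "1 \<le> measure M A + measure (density M L) (space M - A) + 1/2"
    by (rule ennreal_le_iff[THEN iffD1, rotated]) simp
  then show ?thesis by simp
qed

section \<open>Regression with Gaussian noise and its likelihood ratios\<close>

lemma measurable_normal_density_mean [measurable]:
  assumes [measurable]: "f \<in> borel_measurable M" "g \<in> borel_measurable M"
  shows "(\<lambda>x. normal_density (f x) \<sigma> (g x)) \<in> borel_measurable M"
  unfolding normal_density_def by measurable

text \<open>The joint law of (x, y) when y given x is normal with mean \<open>\<mu> x\<close>. All
  means share the reference measure \<open>P \<Otimes>\<^sub>M lborel\<close>, so likelihood ratios
  are quotients of normal densities.\<close>

definition gaussian_regression :: "'a measure \<Rightarrow> real \<Rightarrow> ('a \<Rightarrow> real) \<Rightarrow> ('a \<times> real) measure" where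
  "gaussian_regression P \<sigma> \<mu> = density (P \<Otimes>\<^sub>M lborel) (\<lambda>(x, y). ennreal (normal_density (\<mu> x) \<sigma> y))"

lemma nn_integral_normal_density:
  assumes "\<sigma> > 0" shows "(\<integral>\<^sup>+y. ennreal (normal_density \<mu> \<sigma> y) \<partial>lborel) = 1"
proof -
  interpret prob_space "density lborel (normal_density \<mu> \<sigma>)" by (rule prob_space_normal_density) fact
  show ?thesis using emeasure_space_1 by (simp add: emeasure_density)
qed

text \<open>Links the model with additive noise, in which the theorem is stated, to the form with a
  density. In each fibre, Lebesgue measure is invariant under the shift by
  \<open>\<mu> x\<close>.\<close>

lemma distr_gaussian_regression:
  assumes P: "sigma_finite_measure P" and \<mu>[measurable]: "\<mu> \<in> borel_measurable P" and \<sigma>: "\<sigma> > 0"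
  shows "distr (P \<Otimes>\<^sub>M density lborel (normal_density 0 \<sigma>)) (P \<Otimes>\<^sub>M borel) (\<lambda>(x, e). (x, \<mu> x + e))
    = gaussian_regression P \<sigma> \<mu>"
proof (rule measure_eqI)
  show "sets (distr (P \<Otimes>\<^sub>M density lborel (normal_density 0 \<sigma>)) (P \<Otimes>\<^sub>M borel) (\<lambda>(x, e). (x, \<mu> x + e)))
    = sets (gaussian_regression P \<sigma> \<mu>)"
    by (simp add: gaussian_regression_def cong: sets_pair_measure_cong)
next
  interpret N: prob_space "density lborel (normal_density 0 \<sigma>)" by (rule prob_space_normal_density) fact
  fix A assume "A \<in> sets (distr (P \<Otimes>\<^sub>M density lborel (normal_density 0 \<sigma>)) (P \<Otimes>\<^sub>M borel) (\<lambda>(x, e). (x, \<mu> x + e)))"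
  then have A[measurable]: "A \<in> sets (P \<Otimes>\<^sub>M borel)" by simp
  have shift: "(\<integral>\<^sup>+e. ennreal (normal_density 0 \<sigma> e) * indicator A (x, \<mu> x + e) \<partial>lborel)
     = (\<integral>\<^sup>+y. ennreal (normal_density (\<mu> x) \<sigma> y) * indicator A (x, y) \<partial>lborel)" if [simp]: "x \<in> space P" for x
  proof -
    have [measurable]: "(\<lambda>y. ennreal (normal_density (\<mu> x) \<sigma> y) * indicator A (x, y)) \<in> borel_measurable borel"
      by measurable
    show ?thesis
      by (subst nn_integral_real_affine[where c=1 and t="\<mu> x"]) (simp_all add: normal_density_def)
  qed
  have "emeasure (distr (P \<Otimes>\<^sub>M density lborel (normal_density 0 \<sigma>)) (P \<Otimes>\<^sub>M borel) (\<lambda>(x, e). (x, \<mu> x + e))) A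
    = (\<integral>\<^sup>+z. indicator A z \<partial>distr (P \<Otimes>\<^sub>M density lborel (normal_density 0 \<sigma>)) (P \<Otimes>\<^sub>M borel) (\<lambda>(x, e). (x, \<mu> x + e)))"
    by simp
  also have "\<dots> = (\<integral>\<^sup>+z. indicator A (fst z, \<mu> (fst z) + snd z) \<partial>(P \<Otimes>\<^sub>M density lborel (normal_density 0 \<sigma>)))"
    by (subst nn_integral_distr) (auto simp: case_prod_beta)
  also have "\<dots> = (\<integral>\<^sup>+x. \<integral>\<^sup>+e. indicator A (x, \<mu> x + e) \<partial>density lborel (normal_density 0 \<sigma>) \<partial>P)"
    by (subst N.nn_integral_fst[symmetric]) auto
  also have "\<dots> = (\<integral>\<^sup>+x. \<integral>\<^sup>+e. ennreal (normal_density 0 \<sigma> e) * indicator A (x, \<mu> x + e) \<partial>lborel \<partial>P)"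
    by (intro nn_integral_cong nn_integral_density) auto
  also have "\<dots> = (\<integral>\<^sup>+x. \<integral>\<^sup>+y. ennreal (normal_density (\<mu> x) \<sigma> y) * indicator A (x, y) \<partial>lborel \<partial>P)"
    by (intro nn_integral_cong shift)
  also have "\<dots> = emeasure (gaussian_regression P \<sigma> \<mu>) A"
    unfolding gaussian_regression_def
    by (subst emeasure_density) (simp_all add: lborel.nn_integral_fst[symmetric] case_prod_beta)
  finally show "emeasure (distr (P \<Otimes>\<^sub>M density lborel (normal_density 0 \<sigma>)) (P \<Otimes>\<^sub>M borel) (\<lambda>(x, e). (x, \<mu> x + e))) A
     = emeasure (gaussian_regression P \<sigma> \<mu>) A" .
qed

lemma prob_space_gaussian_regression:
  assumes "prob_space P" and [measurable]: "\<mu> \<in> borel_measurable P" and "\<sigma> > 0"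
  shows "prob_space (gaussian_regression P \<sigma> \<mu>)"
proof (rule prob_spaceI)
  interpret prob_space P by fact
  show "emeasure (gaussian_regression P \<sigma> \<mu>) (space (gaussian_regression P \<sigma> \<mu>)) = 1"
    unfolding gaussian_regression_def
    by (subst emeasure_density)
       (simp_all add: sets.top[of "P \<Otimes>\<^sub>M lborel", simplified] lborel.nn_integral_fst[symmetric] nn_integral_normal_density[OF \<open>\<sigma> > 0\<close>]
       emeasure_space_1 case_prod_beta cong: nn_integral_cong_simp)
qed

definition gaussian_likelihood_ratio ::
    "real \<Rightarrow> ('a \<Rightarrow> real) \<Rightarrow> ('a \<Rightarrow> real) \<Rightarrow> 'a \<times> real \<Rightarrow> ennreal" where
  "gaussian_likelihood_ratio \<sigma> \<mu> \<nu> =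
     (\<lambda>(x, y). ennreal (normal_density (\<nu> x) \<sigma> y / normal_density (\<mu> x) \<sigma> y))"

text \<open>The law of x is the same in both models and cancels from the ratio, so only the normal
  densities of y given x enter. The last integral is one plus the chi-square divergence, the
  quantity that \<open>two_point_testing\<close> controls.\<close>

lemma
  assumes [measurable]: "\<mu> \<in> borel_measurable P" "\<nu> \<in> borel_measurable P" and \<sigma>: "\<sigma> > 0"
  shows measurable_gaussian_likelihood_ratio:
      "gaussian_likelihood_ratio \<sigma> \<mu> \<nu> \<in> borel_measurable (gaussian_regression P \<sigma> \<mu>)"
    and gaussian_regression_density: "gaussian_regression P \<sigma> \<nu>
      = density (gaussian_regression P \<sigma> \<mu>) (gaussian_likelihood_ratio \<sigma> \<mu> \<nu>)"
    and gaussian_chi_square: "(\<integral>\<^sup>+z. (gaussian_likelihood_ratio \<sigma> \<mu> \<nu> z)\<^sup>2 \<partial>gaussian_regression P \<sigma> \<mu>)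
      = (\<integral>\<^sup>+x. ennreal (exp ((\<nu> x - \<mu> x)\<^sup>2 / \<sigma>\<^sup>2)) \<partial>P)"
proof -
  have m[measurable]: "gaussian_likelihood_ratio \<sigma> \<mu> \<nu> \<in> borel_measurable (P \<Otimes>\<^sub>M lborel)"
    unfolding gaussian_likelihood_ratio_def by measurable
  then show "gaussian_likelihood_ratio \<sigma> \<mu> \<nu> \<in> borel_measurable (gaussian_regression P \<sigma> \<mu>)"
    by (simp add: gaussian_regression_def)
  have pos: "0 < normal_density a \<sigma> y" for a y by (rule normal_density_pos[OF \<sigma>])
  show "gaussian_regression P \<sigma> \<nu> = density (gaussian_regression P \<sigma> \<mu>) (gaussian_likelihood_ratio \<sigma> \<mu> \<nu>)"
    unfolding gaussian_regression_def
    by (subst density_density_eq)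
       (auto simp: gaussian_likelihood_ratio_def ennreal_mult[symmetric] less_imp_le[OF pos] less_imp_neq[OF pos, symmetric]
         intro!: density_cong)
  \<comment> \<open>Completing the square gives another Gaussian density, which integrates to 1.\<close>
  have sq: "normal_density a \<sigma> y * (normal_density b \<sigma> y / normal_density a \<sigma> y)\<^sup>2
     = exp ((b - a)\<^sup>2 / \<sigma>\<^sup>2) * normal_density (2 * b - a) \<sigma> y" for a b y
  proof -
    have e: "exp (-(y-b)\<^sup>2/(2*\<sigma>\<^sup>2)) ^ 2 = exp ((b - a)\<^sup>2 / \<sigma>\<^sup>2) * exp (-(y-(2*b-a))\<^sup>2/(2*\<sigma>\<^sup>2)) * exp (-(y-a)\<^sup>2/(2*\<sigma>\<^sup>2))"
      unfolding exp_add[symmetric] exp_double[symmetric]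
      using \<sigma> by (simp add: field_simps power2_eq_square)
    have "normal_density b \<sigma> y ^ 2 = exp ((b - a)\<^sup>2 / \<sigma>\<^sup>2) * normal_density (2 * b - a) \<sigma> y * normal_density a \<sigma> y"
      unfolding normal_density_def power_mult_distrib e by (simp add: power2_eq_square)
    then show ?thesis using pos[of a y] by (simp add: field_simps power2_eq_square)
  qed
  have "(\<integral>\<^sup>+z. (gaussian_likelihood_ratio \<sigma> \<mu> \<nu> z)\<^sup>2 \<partial>gaussian_regression P \<sigma> \<mu>)
     = (\<integral>\<^sup>+z. ennreal (normal_density (\<mu> (fst z)) \<sigma> (snd z)) * (gaussian_likelihood_ratio \<sigma> \<mu> \<nu> z)\<^sup>2 \<partial>(P \<Otimes>\<^sub>M lborel))"
    unfolding gaussian_regression_def by (subst nn_integral_density) (auto simp: case_prod_beta)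
  also have "\<dots> = (\<integral>\<^sup>+z. ennreal (exp ((\<nu> (fst z) - \<mu> (fst z))\<^sup>2 / \<sigma>\<^sup>2) * normal_density (2 * \<nu> (fst z) - \<mu> (fst z)) \<sigma> (snd z)) \<partial>(P \<Otimes>\<^sub>M lborel))"
    unfolding sq[symmetric] gaussian_likelihood_ratio_def
    by (intro nn_integral_cong) (auto simp: case_prod_beta ennreal_mult ennreal_power less_imp_le[OF pos])
  also have "\<dots> = (\<integral>\<^sup>+x. \<integral>\<^sup>+y. ennreal (exp ((\<nu> x - \<mu> x)\<^sup>2 / \<sigma>\<^sup>2)) * ennreal (normal_density (2 * \<nu> x - \<mu> x) \<sigma> y) \<partial>lborel \<partial>P)"
    by (subst lborel.nn_integral_fst[symmetric]) (auto simp: ennreal_mult)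
  also have "\<dots> = (\<integral>\<^sup>+x. ennreal (exp ((\<nu> x - \<mu> x)\<^sup>2 / \<sigma>\<^sup>2)) \<partial>P)"
    by (simp add: nn_integral_cmult nn_integral_normal_density[OF \<sigma>])
  finally show "(\<integral>\<^sup>+z. (gaussian_likelihood_ratio \<sigma> \<mu> \<nu> z)\<^sup>2 \<partial>gaussian_regression P \<sigma> \<mu>)
      = (\<integral>\<^sup>+x. ennreal (exp ((\<nu> x - \<mu> x)\<^sup>2 / \<sigma>\<^sup>2)) \<partial>P)" .
qed

text \<open>By independence, the second moment of the likelihood ratio of the sample is the n-th
  power of that of one observation, and \<open>two_point_testing\<close> applies.\<close>

lemma product_gaussian_testing:
  assumes P: "prob_space P" and [measurable]: "\<mu> \<in> borel_measurable P" "\<nu> \<in> borel_measurable P" and \<sigma>: "\<sigma> > 0"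
    and chi: "(\<integral>\<^sup>+x. ennreal (exp ((\<nu> x - \<mu> x)\<^sup>2 / \<sigma>\<^sup>2)) \<partial>P) ^ n \<le> 2"
    and A: "A \<in> sets (\<Pi>\<^sub>M i\<in>{..<n}. gaussian_regression P \<sigma> \<mu>)"
  shows "1/2 \<le> measure (\<Pi>\<^sub>M i\<in>{..<n}. gaussian_regression P \<sigma> \<mu>) A
     + measure (\<Pi>\<^sub>M i\<in>{..<n}. gaussian_regression P \<sigma> \<nu>) (space (\<Pi>\<^sub>M i\<in>{..<n}. gaussian_regression P \<sigma> \<mu>) - A)"
proof -
  let ?L = "gaussian_likelihood_ratio \<sigma> \<mu> \<nu>"
  note L[measurable] = measurable_gaussian_likelihood_ratio[OF assms(2,3) \<sigma>]
  note dens = gaussian_regression_density[OF assms(2,3) \<sigma>]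
  note M = prob_space_gaussian_regression[OF P assms(2) \<sigma>]
  note N = prob_space_gaussian_regression[OF P assms(3) \<sigma>]
  interpret Mi: product_prob_space "\<lambda>_::nat. gaussian_regression P \<sigma> \<mu>" "{..<n}"
    by (intro product_prob_spaceI M)
  interpret Ni: product_prob_space "\<lambda>_::nat. gaussian_regression P \<sigma> \<nu>" "{..<n}"
    by (intro product_prob_spaceI N)
  have pd: "(\<Pi>\<^sub>M i\<in>{..<n}. gaussian_regression P \<sigma> \<nu>)
    = density (\<Pi>\<^sub>M i\<in>{..<n}. gaussian_regression P \<sigma> \<mu>) (\<lambda>\<omega>. \<Prod>i<n. ?L (\<omega> i))"
    unfolding dens using N unfolding dens by (intro PiM_density M L) auto
  have pm: "(\<lambda>\<omega>. \<Prod>i<n. ?L (\<omega> i)) \<in> borel_measurable (\<Pi>\<^sub>M i\<in>{..<n}. gaussian_regression P \<sigma> \<mu>)"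
    by (intro borel_measurable_prod_ennreal measurable_compose[OF _ L] measurable_component_singleton)
  have "(\<integral>\<^sup>+\<omega>. (\<Prod>i<n. ?L (\<omega> i))\<^sup>2 \<partial>(\<Pi>\<^sub>M i\<in>{..<n}. gaussian_regression P \<sigma> \<mu>))
     = (\<integral>\<^sup>+\<omega>. (\<Prod>i<n. (?L (\<omega> i))\<^sup>2) \<partial>(\<Pi>\<^sub>M i\<in>{..<n}. gaussian_regression P \<sigma> \<mu>))"
    by (simp add: prod_power_distrib)
  also have "\<dots> = (\<Prod>i<n. \<integral>\<^sup>+z. (?L z)\<^sup>2 \<partial>gaussian_regression P \<sigma> \<mu>)"
    by (rule Mi.product_nn_integral_prod) auto
  also have "\<dots> \<le> 2"
    using chi by (simp add: gaussian_chi_square[OF assms(2,3) \<sigma>])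
  finally have "(\<integral>\<^sup>+\<omega>. (\<Prod>i<n. ?L (\<omega> i))\<^sup>2 \<partial>(\<Pi>\<^sub>M i\<in>{..<n}. gaussian_regression P \<sigma> \<mu>)) \<le> 2" .
  then show ?thesis
    using Ni.prob_space_axioms unfolding pd
    by (intro two_point_testing pm A Mi.prob_space_axioms)
qed

subsection \<open>Assouad's lemma\<close>

text \<open>\<open>A j\<close> is the event that the j-th test decides for membership of j. Averaged
  over all 2^J sets v, the expected number of wrong tests is at least J/4, hence at least J/4 for
  some v. As the number never exceeds J, it reaches J/8 with probability at least 1/8.\<close>

lemma assouad:
  fixes \<P> :: "nat set \<Rightarrow> 'a measure"
  assumes J: "J > 0"
    and prob: "\<And>v. v \<subseteq> {..<J} \<Longrightarrow> prob_space (\<P> v)"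
    and sets: "\<And>v. v \<subseteq> {..<J} \<Longrightarrow> sets (\<P> v) = sets M"
    and A: "\<And>j. j < J \<Longrightarrow> A j \<in> sets M"
    and test: "\<And>j v. j < J \<Longrightarrow> v \<subseteq> {..<J} \<Longrightarrow> j \<notin> v \<Longrightarrow>
      1/2 \<le> measure (\<P> v) (A j) + measure (\<P> (insert j v)) (space M - A j)"
  shows "\<exists>v\<subseteq>{..<J}. 1/8 \<le> measure (\<P> v)
    {\<omega> \<in> space M. real J / 8 \<le> real (card {j \<in> {..<J}. (\<omega> \<in> A j) \<noteq> (j \<in> v)})}"
proof -
  \<comment> \<open>The event that the j-th test is wrong when v is the truth.\<close>
  define err where "err v j = (if j \<in> v then space M - A j else A j)" for v j
  define e where "e v j = measure (\<P> v) (err v j)" for v j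
  have err_sets: "err v j \<in> sets M" if "j < J" for v j
    using A[OF that] by (auto simp: err_def)
  \<comment> \<open>Averaging over all \<open>v\<close>, pair \<open>v\<close> with the set that differs from it in \<open>j\<close> only.\<close>
  have half: "real (2^J) / 4 \<le> (\<Sum>v\<in>Pow {..<J}. e v j)" if j: "j < J" for j
  proof -
    \<comment> \<open>\<open>tog\<close> is an involution of the power set, so the toggled sum
      equals the original one. The bound 1/2 per set is shared by two equal sums, which leaves 1/4
      for each.\<close>
    define tog where "tog v = (if j \<in> v then v - {j} else insert j v)" for v
    have "(\<Sum>v\<in>Pow {..<J}. e v j) = (\<Sum>v\<in>Pow {..<J}. e (tog v) j)"
      using j by (intro sum.reindex_bij_witness[of _ tog tog]) (auto simp: tog_def insert_absorb)
    moreover have "real (2^J) / 2 = (\<Sum>v\<in>Pow {..<J}. 1/2)"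
      by (simp add: card_Pow)
    moreover have "\<dots> \<le> (\<Sum>v\<in>Pow {..<J}. e v j + e (tog v) j)"
    proof (intro sum_mono)
      fix v assume v: "v \<in> Pow {..<J}"
      show "1/2 \<le> e v j + e (tog v) j"
      proof (cases "j \<in> v")
        case True
        have "v - {j} \<subseteq> {..<J}" using v by auto
        then show ?thesis
          using True test[OF j, of "v - {j}"] by (auto simp: e_def err_def tog_def insert_absorb)
      next
        case False
        then show ?thesis using test[OF j, of v] v by (auto simp: e_def err_def tog_def)
      qed
    qed
    ultimately show ?thesis by (simp add: sum.distrib)
  qed
  \<comment> \<open>Pigeonhole: if every v stayed below J/4, exchanging the two sums would
    contradict \<open>half\<close> summed over j.\<close>
  have "\<exists>v\<in>Pow {..<J}. real J / 4 \<le> (\<Sum>j<J. e v j)"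
  proof (rule ccontr)
    assume "\<not> ?thesis"
    then have "(\<Sum>v\<in>Pow {..<J}. \<Sum>j<J. e v j) < (\<Sum>v\<in>Pow {..<J}. real J / 4)"
      by (intro sum_strict_mono) (auto simp: not_le)
    moreover have "(\<Sum>v\<in>Pow {..<J}. \<Sum>j<J. e v j) = (\<Sum>j<J. \<Sum>v\<in>Pow {..<J}. e v j)"
      by (rule sum.swap)
    moreover have "(\<Sum>j<J. real (2^J) / 4) \<le> (\<Sum>j<J. \<Sum>v\<in>Pow {..<J}. e v j)"
      by (intro sum_mono half) auto
    ultimately show False by (simp add: card_Pow mult.commute)
  qed
  then obtain v where v: "v \<subseteq> {..<J}" and ev: "real J / 4 \<le> (\<Sum>j<J. e v j)" by auto
  interpret prob_space "\<P> v" by (rule prob[OF v])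
  have sp: "space (\<P> v) = space M" using sets[OF v] by (rule sets_eq_imp_space_eq)
  have ms[measurable]: "err v j \<in> sets (\<P> v)" if "j < J" for j
    using err_sets[OF that] sets[OF v] by auto
  define N where "N \<omega> = (\<Sum>j<J. indicator (err v j) \<omega> :: real)" for \<omega>
  have N: "real (card {j \<in> {..<J}. (\<omega> \<in> A j) \<noteq> (j \<in> v)}) = N \<omega>" if "\<omega> \<in> space M" for \<omega>
    unfolding N_def using that
    by (auto simp: indicator_def err_def sum.If_cases intro!: arg_cong[where f=card])
  have Nm[measurable]: "N \<in> borel_measurable (\<P> v)"
    unfolding N_def by measurable
  define G where "G = {\<omega> \<in> space (\<P> v). real J / 8 \<le> N \<omega>}"
  have [measurable]: "G \<in> sets (\<P> v)" unfolding G_def by measurable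
  have NJ: "N \<omega> \<le> real J" for \<omega>
    unfolding N_def using sum_bounded_above[of "{..<J}" "\<lambda>j. indicator (err v j) \<omega> :: real" 1]
    by (simp add: indicator_def)
  have "(\<Sum>j<J. e v j) = expectation N"
    unfolding N_def e_def by (subst Bochner_Integration.integral_sum) (auto simp: emeasure_eq_measure)
  \<comment> \<open>Off \<open>G\<close> the number of wrong tests is below J/8, on \<open>G\<close>
    it is at most J. Since the mean is at least J/4, the event \<open>G\<close> accounts for the
    remaining J/8.\<close>
  also have "\<dots> \<le> expectation (\<lambda>\<omega>. real J / 8 + real J * indicator G \<omega>)"
  proof (intro integral_mono)
    show "integrable (\<P> v) N" unfolding N_def by (intro Bochner_Integration.integrable_sum) (auto simp: emeasure_eq_measure)
    show "integrable (\<P> v) (\<lambda>\<omega>. real J / 8 + real J * indicator G \<omega>)" by (auto simp: emeasure_eq_measure)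
    show "N \<omega> \<le> real J / 8 + real J * indicator G \<omega>" if "\<omega> \<in> space (\<P> v)" for \<omega>
      using that NJ[of \<omega>] by (auto simp: G_def indicator_def)
  qed
  also have "\<dots> = real J / 8 + real J * prob G"
    by (simp add: emeasure_eq_measure prob_space)
  finally have "real J * (1/8) \<le> real J * prob G" using ev by simp
  then have "1/8 \<le> prob G" using J by simp
  moreover have "G = {\<omega> \<in> space M. real J / 8 \<le> real (card {j \<in> {..<J}. (\<omega> \<in> A j) \<noteq> (j \<in> v)})}"
    unfolding G_def sp by (intro Collect_cong conj_cong refl) (simp only: N)
  ultimately show ?thesis using v by auto
qed

subsection \<open>Perturbed convex links\<close>

definition hinge :: "real \<Rightarrow> real" where
  "hinge u = max 0 (u - 1/2)"

text \<open>Agrees with \<open>hinge\<close> outside (0, 1): zero to the left, u - 1/2 to the right.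
  Exchanging the two is therefore invisible from the other cells, and both are convex.\<close>

definition split_hinge :: "real \<Rightarrow> real" where
  "split_hinge u = (max 0 u + max 0 (u - 1)) / 2"

text \<open>The surplus of \<open>split_hinge\<close> over \<open>hinge\<close>, with peak 1/4 at
  the middle of the cell.\<close>

definition tent :: "real \<Rightarrow> real" where
  "tent u = max 0 (1/2 - \<bar>u - 1/2\<bar>) / 2"

text \<open>The scale J t - j maps the j-th cell [j/J, (j+1)/J] onto [0, 1].\<close>
definition perturbed_link :: "real \<Rightarrow> nat \<Rightarrow> nat set \<Rightarrow> real \<Rightarrow> real" where
  "perturbed_link c J v t =
     (\<Sum>j<J. c / (real J)\<^sup>2 * (if j \<in> v then split_hinge else hinge) (real J * t - real j))"

lemma split_hinge_eq: "split_hinge u = hinge u + tent u"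
  by (auto simp: split_hinge_def hinge_def tent_def max_def abs_if)

lemma tent_nonneg: "0 \<le> tent u"
  by (simp add: tent_def)

lemma tent_le: "tent u \<le> 1/4"
  by (auto simp: tent_def max_def)

lemma tent_eq_0: "u \<notin> {0<..<1} \<Longrightarrow> tent u = 0"
  by (auto simp: tent_def max_def abs_if)

lemma tent_ge: "u \<in> {1/4..3/4} \<Longrightarrow> 1/8 \<le> tent u"
  by (auto simp: tent_def max_def abs_if)

text \<open>Each split adds one tent, so v enters additively. Convexity is read off the hinges,
  differences between links off the tents.\<close>

lemma perturbed_link_eq:
  assumes "v \<subseteq> {..<J}"
  shows "perturbed_link c J v t
    = perturbed_link c J {} t + (\<Sum>j\<in>v. c / (real J)\<^sup>2 * tent (real J * t - real j))"
proof -
  have "perturbed_link c J v t = (\<Sum>j<J. c / (real J)\<^sup>2 * hinge (real J * t - real j)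
      + (if j \<in> v then c / (real J)\<^sup>2 * tent (real J * t - real j) else 0))"
    unfolding perturbed_link_def
    by (intro sum.cong) (auto simp: split_hinge_eq distrib_left add_divide_distrib)
  also have "\<dots> = perturbed_link c J {} t
      + (\<Sum>j\<in>{..<J} \<inter> v. c / (real J)\<^sup>2 * tent (real J * t - real j))"
    by (simp only: sum.distrib sum.inter_restrict[OF finite_lessThan]) (simp add: perturbed_link_def)
  finally show ?thesis using assms by (simp add: Int_absorb1)
qed

lemma perturbed_link_insert:
  assumes "v \<subseteq> {..<J}" "j < J" "j \<notin> v"
  shows "perturbed_link c J (insert j v) t
    = perturbed_link c J v t + c / (real J)\<^sup>2 * tent (real J * t - real j)"
  using assms perturbed_link_eq[of v J c t] perturbed_link_eq[of "insert j v" J c t]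
  by (auto simp: finite_subset)

text \<open>Tents of different cells have disjoint interiors, so on the j-th cell only the
  membership of j matters. This lets a test for j work with the two candidates \<open>{}\<close> and
  \<open>{j}\<close>, whatever v is.\<close>

lemma perturbed_link_local:
  assumes v: "v \<subseteq> {..<J}" and t: "real J * t - real j \<in> {0..1}"
  shows "perturbed_link c J v t = perturbed_link c J (v \<inter> {j}) t"
proof -
  have "tent (real J * t - real i) = 0" if "i \<noteq> j" for i
  proof (rule tent_eq_0)
    have "real i + 1 \<le> real j \<or> real j + 1 \<le> real i" using that by linarith
    then show "real J * t - real i \<notin> {0<..<1}" using t by auto
  qed
  then have "(\<Sum>i\<in>v. c / (real J)\<^sup>2 * tent (real J * t - real i))
      = (\<Sum>i\<in>v \<inter> {j}. c / (real J)\<^sup>2 * tent (real J * t - real i))"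
    using v by (intro sum.mono_neutral_right) (auto intro: finite_subset)
  then show ?thesis
    using perturbed_link_eq[OF v] perturbed_link_eq[of "v \<inter> {j}" J] v by (auto simp: le_infI1)
qed

lemma continuous_on_perturbed_link: "continuous_on UNIV (perturbed_link c J v)"
proof -
  have "continuous_on UNIV (\<lambda>t. (if j \<in> v then split_hinge else hinge) (real J * t - real j))" for j
    by (cases "j \<in> v") (auto simp: split_hinge_def hinge_def intro!: continuous_intros)
  then show ?thesis
    unfolding perturbed_link_def by (intro continuous_intros)
qed

text \<open>A combination, with nonnegative weights, of positive parts of affine functions.\<close>

lemma convex_on_perturbed_link:
  assumes "c \<ge> 0" "convex D"
  shows "convex_on D (perturbed_link c J v)"
proof (rule convex_onI[OF _ \<open>convex D\<close>])
  fix s x y :: real assume s: "0 < s" "s < 1"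
  \<comment> \<open>Convexity of the positive part with its kink at k. The kinks in use are 0 and 1
    for \<open>split_hinge\<close> and 1/2 for \<open>hinge\<close>.\<close>
  have pos: "max 0 ((1 - s) * a + s * b - k) \<le> (1 - s) * max 0 (a - k) + s * max 0 (b - k)" for a b k
  proof -
    have "(1 - s) * a + s * b - k = (1 - s) * (a - k) + s * (b - k)" by (simp add: algebra_simps)
    also have "\<dots> \<le> (1 - s) * max 0 (a - k) + s * max 0 (b - k)"
      using s by (intro add_mono mult_left_mono) auto
    finally show ?thesis using s by (auto intro!: add_nonneg_nonneg mult_nonneg_nonneg)
  qed
  define H where "H j = (if j \<in> v then split_hinge else hinge)" for j
  have H: "H j ((1 - s) * a + s * b) \<le> (1 - s) * H j a + s * H j b" for j a b
  proof (cases "j \<in> v")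
    case True
    have "2 * H j ((1 - s) * a + s * b)
      \<le> ((1 - s) * max 0 a + s * max 0 b) + ((1 - s) * max 0 (a - 1) + s * max 0 (b - 1))"
      using True add_mono[OF pos[of a b 0] pos[of a b 1]] by (simp add: H_def split_hinge_def)
    also have "\<dots> = 2 * ((1 - s) * H j a + s * H j b)"
      using True by (simp add: H_def split_hinge_def field_simps)
    finally show ?thesis by simp
  next
    case False
    then show ?thesis using pos by (simp add: H_def hinge_def)
  qed
  have "H j (real J * ((1 - s) * x + s * y) - real j)
     \<le> (1 - s) * H j (real J * x - real j) + s * H j (real J * y - real j)" for j
    using H[of j "real J * x - real j" "real J * y - real j"] by (simp add: algebra_simps)
  then have "perturbed_link c J v ((1 - s) * x + s * y)
     \<le> (\<Sum>j<J. c / (real J)\<^sup>2 * ((1 - s) * H j (real J * x - real j) + s * H j (real J * y - real j)))"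
    unfolding perturbed_link_def H_def[symmetric] using \<open>c \<ge> 0\<close>
    by (intro sum_mono mult_left_mono) auto
  also have "\<dots> = (1 - s) * perturbed_link c J v x + s * perturbed_link c J v y"
    unfolding perturbed_link_def H_def[symmetric] sum_distrib_left sum.distrib[symmetric]
    by (intro sum.cong refl) (simp only: distrib_left mult.left_commute)
  finally show "perturbed_link c J v ((1 - s) *\<^sub>R x + s *\<^sub>R y)
     \<le> (1 - s) * perturbed_link c J v x + s * perturbed_link c J v y" by simp
qed

text \<open>Both hinges have slope at most 1, so after rescaling each of the J summands has slope at
  most (c / J^2) * J = c / J. The slopes add up to at most c, uniformly in J.\<close>

lemma lipschitz_on_perturbed_link:
  assumes "c \<ge> 0"
  shows "c-lipschitz_on D (perturbed_link c J v)"
proof (rule lipschitz_onI[OF _ assms])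
  fix x y :: real
  define H where "H j = (if j \<in> v then split_hinge else hinge)" for j
  have "\<bar>H j a - H j b\<bar> \<le> \<bar>a - b\<bar>" for j a b
    by (auto simp: H_def split_hinge_def hinge_def max_def abs_if field_simps)
  from this[of _ "real J * x - real j" "real J * y - real j" for j]
  have H: "\<bar>H j (real J * x - real j) - H j (real J * y - real j)\<bar> \<le> real J * \<bar>x - y\<bar>" for j
    by (simp add: right_diff_distrib[symmetric] abs_mult)
  have "\<bar>perturbed_link c J v x - perturbed_link c J v y\<bar> \<le> (\<Sum>j<J. c / (real J)\<^sup>2 * (real J * \<bar>x - y\<bar>))"
    unfolding perturbed_link_def H_def[symmetric] sum_subtractf[symmetric] right_diff_distrib[symmetric]
    using \<open>c \<ge> 0\<close> H by (intro order_trans[OF sum_abs] sum_mono) (auto simp: abs_mult intro!: mult_left_mono divide_right_mono)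
  also have "\<dots> \<le> c * \<bar>x - y\<bar>" using \<open>c \<ge> 0\<close> by (simp add: power2_eq_square)
  finally show "dist (perturbed_link c J v x) (perturbed_link c J v y) \<le> c * dist x y"
    by (simp add: dist_real_def)
qed

subsection \<open>The support of a law\<close>

text \<open>Separability: the complement is a countable union of null boxes with rational corners.\<close>
lemma
  assumes P: "sets P = sets (vec_space d)"
  shows sets_support_d: "support_d d P \<in> sets P"
    and AE_support_d: "AE x in P. x \<in> support_d d P"
proof -
  define Q where "Q = PiE {..<d} (\<lambda>_. \<rat> :: real set)"
  define box where "box p q = PiE {..<d} (\<lambda>i. {p i<..<q i :: real})" for p q :: "nat \<Rightarrow> real"
  define Z where "Z = {(p, q) \<in> Q \<times> Q. emeasure P (box p q) = 0}"
  have "countable (Q \<times> Q)"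
    unfolding Q_def by (intro countable_SIGMA countable_PiE countable_rat) auto
  then have Z: "countable Z" by (rule countable_subset[rotated]) (auto simp: Z_def)
  have box[measurable]: "box p q \<in> sets P" for p q
    unfolding box_def P vec_space_def by (intro sets_PiM_I_finite) auto
  have ball: "{y \<in> space (vec_space d). norm_d d (\<lambda>i. y i - x i) < r} \<in> sets P" for x r
    unfolding norm_d_def L2_set_def P vec_space_def by measurable
  have spP: "space P = space (vec_space d)" using P by (rule sets_eq_imp_space_eq)
  have compl: "space P - support_d d P = (\<Union>(p, q)\<in>Z. box p q)"
  proof (intro equalityI subsetI)
    fix x assume "x \<in> space P - support_d d P"
    then obtain r where x: "x \<in> space (vec_space d)" and r: "r > 0"
      and 0: "emeasure P {y \<in> space (vec_space d). norm_d d (\<lambda>i. y i - x i) < r} = 0"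
      by (auto simp: support_d_def spP)
    \<comment> \<open>The Euclidean norm is at most the sum of the d coordinate deviations, each at
      most s, and d * s < r. The added 1 makes this strict and covers d = 0.\<close>
    define s where "s = r / (real d + 1)"
    have s: "s > 0" using r by (simp add: s_def)
    have "\<forall>i. \<exists>p\<in>\<rat>. x i - s < p \<and> p < x i" "\<forall>i. \<exists>q\<in>\<rat>. x i < q \<and> q < x i + s"
      using s by (auto intro!: Rats_dense_in_real)
    then obtain p q where p: "\<And>i. p i \<in> \<rat>" "\<And>i. x i - s < p i" "\<And>i. p i < x i"
      and q: "\<And>i. q i \<in> \<rat>" "\<And>i. x i < q i" "\<And>i. q i < x i + s" by metis
    \<comment> \<open>Restriction makes the corners elements of \<open>Q\<close>, which is countable
      because its functions are fixed outside \<open>{..<d}\<close>.\<close>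
    define p' q' where "p' = restrict p {..<d}" and "q' = restrict q {..<d}"
    have "box p' q' \<subseteq> {y \<in> space (vec_space d). norm_d d (\<lambda>i. y i - x i) < r}"
    proof
      fix y assume y: "y \<in> box p' q'"
      have "norm_d d (\<lambda>i. y i - x i) \<le> (\<Sum>i<d. \<bar>y i - x i\<bar>)"
        unfolding norm_d_def by (rule L2_set_le_sum_abs)
      also have "\<dots> \<le> (\<Sum>i<d. s)"
      proof (intro sum_mono)
        fix i assume "i \<in> {..<d}"
        then have "p i < y i" "y i < q i" using y by (auto simp: box_def p'_def q'_def PiE_iff)
        then show "\<bar>y i - x i\<bar> \<le> s" using p(2)[of i] q(3)[of i] by linarith
      qed
      also have "\<dots> < r" using r by (simp add: s_def field_simps)
      finally show "y \<in> {y \<in> space (vec_space d). norm_d d (\<lambda>i. y i - x i) < r}"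
        using y by (auto simp: box_def vec_space_def space_PiM PiE_iff)
    qed
    then have "emeasure P (box p' q') \<le> 0" unfolding 0[symmetric] by (rule emeasure_mono[OF _ ball])
    then have "(p', q') \<in> Z" using p q by (auto simp: Z_def Q_def p'_def q'_def)
    moreover have "x \<in> box p' q'"
      using x p q by (auto simp: box_def p'_def q'_def vec_space_def space_PiM PiE_iff)
    ultimately show "x \<in> (\<Union>(p, q)\<in>Z. box p q)" by auto
  next
    fix x assume "x \<in> (\<Union>(p, q)\<in>Z. box p q)"
    then obtain p q where x: "x \<in> box p q" and 0: "emeasure P (box p q) = 0" by (auto simp: Z_def)
    then have xs: "x \<in> space (vec_space d)"
      by (auto simp: box_def vec_space_def space_PiM PiE_iff)
    \<comment> \<open>The distance from x to the faces of the box, capped at 1 so that the minimum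
      is over a nonempty set when d = 0. Coordinates are bounded by the Euclidean norm, so the ball
      of this radius lies in the box.\<close>
    define r where "r = Min (insert 1 ((\<lambda>i. min (x i - p i) (q i - x i)) ` {..<d}))"
    have r: "r > 0" unfolding r_def using x by (subst Min_gr_iff) (auto simp: box_def PiE_iff)
    have ri: "r \<le> x i - p i" "r \<le> q i - x i" if "i < d" for i
    proof -
      have "r \<le> min (x i - p i) (q i - x i)" unfolding r_def using that by (intro Min_le) auto
      then show "r \<le> x i - p i" "r \<le> q i - x i" by auto
    qed
    have "{y \<in> space (vec_space d). norm_d d (\<lambda>i. y i - x i) < r} \<subseteq> box p q"
    proof safe
      fix y assume y: "y \<in> space (vec_space d)" and n: "norm_d d (\<lambda>i. y i - x i) < r"
      have "\<bar>y i - x i\<bar> < r" if "i < d" for i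
        using member_le_L2_set[of "{..<d}" i "\<lambda>i. \<bar>y i - x i\<bar>"] that n
        by (auto simp: norm_d_def L2_set_def)
      then have "p i < y i \<and> y i < q i" if "i < d" for i using ri[OF that] that by fastforce
      then show "y \<in> box p q" using y by (auto simp: box_def vec_space_def space_PiM PiE_iff)
    qed
    then have "emeasure P {y \<in> space (vec_space d). norm_d d (\<lambda>i. y i - x i) < r} \<le> 0"
      unfolding 0[symmetric] by (rule emeasure_mono) simp
    then show "x \<in> space P - support_d d P"
      using r xs by (auto simp: support_d_def spP intro!: exI[of _ r])
  qed
  have nZ: "(\<Union>(p, q)\<in>Z. box p q) \<in> null_sets P"
    using Z by (intro null_sets_UN') (auto simp: Z_def null_sets_def)
  have "support_d d P = space P - (space P - support_d d P)"
    by (auto simp: support_d_def spP)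
  then show "support_d d P \<in> sets P"
    using nZ unfolding compl by (metis null_setsD2 sets.compl_sets)
  show "AE x in P. x \<in> support_d d P"
    by (rule AE_I'[OF nZ]) (auto simp: compl[symmetric])
qed

subsection \<open>Separation of the perturbed links\<close>

lemma emeasure_uniform_interval:
  assumes [measurable]: "T \<in> borel_measurable P"
    and T: "distr P borel T = uniform_measure lborel {0..1::real}"
    and ab: "0 \<le> a" "a \<le> b" "b \<le> 1"
  shows "emeasure P {x \<in> space P. T x \<in> {a..b}} = ennreal (b - a)"
proof -
  have "emeasure P {x \<in> space P. T x \<in> {a..b}} = emeasure (distr P borel T) {a..b}"
    by (subst emeasure_distr) (auto intro!: arg_cong2[where f=emeasure])
  also have "\<dots> = emeasure lborel ({0..1} \<inter> {a..b}) / emeasure lborel {0..1::real}"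
    unfolding T by (rule emeasure_uniform_measure) auto
  also have "{0..1} \<inter> {a..b} = {a..b}" using ab by auto
  finally show ?thesis using ab by (simp add: divide_ennreal_def)
qed

text \<open>The means differ by at most c / (4 J^2), and only on a cell of probability 1/J. As c
  \<le> \<sigma>, one observation has chi-square divergence at most 1/(8 J^5) \<le> 1/(8 n), and n
  observations give a second moment of at most exp(1/8) < 2. The condition n \<le> J^5 is what makes
  J of order n^(1/5).\<close>

lemma tent_chi_square:
  assumes P: "prob_space P" and T[measurable]: "T \<in> borel_measurable P"
    and unif: "distr P borel T = uniform_measure lborel {0..1::real}"
    and [measurable]: "\<mu> \<in> borel_measurable P" "\<nu> \<in> borel_measurable P"
    and c: "0 \<le> c" "c \<le> \<sigma>" "0 < \<sigma>" and j: "j < J" and n: "1 \<le> n" "n \<le> J ^ 5"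
    and diff: "\<And>x. x \<in> space P \<Longrightarrow> \<bar>\<nu> x - \<mu> x\<bar> \<le> c / (real J)\<^sup>2 * tent (real J * T x - real j)"
  shows "(\<integral>\<^sup>+x. ennreal (exp ((\<nu> x - \<mu> x)\<^sup>2 / \<sigma>\<^sup>2)) \<partial>P) ^ n \<le> 2"
proof -
  interpret prob_space P by fact
  have J: "real J \<ge> 1" using j by simp
  define I where "I = {x \<in> space P. T x \<in> {real j / real J..(real j + 1) / real J}}"
  have [measurable]: "I \<in> sets P" unfolding I_def by measurable
  have eI: "emeasure P I = ennreal (1 / real J)"
  proof -
    have "(real j + 1) / real J - real j / real J = 1 / real J" by (simp add: add_divide_distrib)
    moreover have "(real j + 1) / real J \<le> 1" "real j / real J \<le> (real j + 1) / real J"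
      using j J by (auto simp: field_simps)
    ultimately show ?thesis
      using emeasure_uniform_interval[OF T unif, of "real j / real J" "(real j + 1) / real J"]
      unfolding I_def by simp
  qed
  \<comment> \<open>On the cell the exponent z is at most 1/(16 J^4) \<le> 1, and exp z \<le> 1 + z
    + z^2 \<le> 1 + 2 z. Off the cell the tent vanishes and the exponent is 0.\<close>
  have pt: "exp ((\<nu> x - \<mu> x)\<^sup>2 / \<sigma>\<^sup>2) \<le> 1 + 1 / (8 * real J ^ 4) * indicator I x" if x: "x \<in> space P" for x
  proof (cases "x \<in> I")
    case True
    define z where "z = (\<nu> x - \<mu> x)\<^sup>2 / \<sigma>\<^sup>2"
    have "\<bar>\<nu> x - \<mu> x\<bar> \<le> c / (real J)\<^sup>2 * (1/4)"
      using c by (intro order_trans[OF diff[OF x]] mult_left_mono tent_le) auto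
    also have "\<dots> \<le> \<sigma> / (real J)\<^sup>2 * (1/4)"
      using c by (intro mult_right_mono divide_right_mono) auto
    finally have "\<bar>\<nu> x - \<mu> x\<bar>\<^sup>2 \<le> (\<sigma> / (real J)\<^sup>2 * (1/4))\<^sup>2"
      by (intro power_mono) auto
    then have "z \<le> (\<sigma> / (real J)\<^sup>2 * (1/4))\<^sup>2 / \<sigma>\<^sup>2"
      unfolding z_def by (intro divide_right_mono) auto
    also have "\<dots> = 1 / (16 * real J ^ 4)"
      using c J by (simp add: field_simps power2_eq_square power4_eq_xxxx)
    finally have z: "z \<le> 1 / (16 * real J ^ 4)" .
    have z0: "0 \<le> z" by (simp add: z_def)
    have "1 \<le> real J ^ 4" using J by (rule one_le_power)
    then have "1 / (16 * real J ^ 4) \<le> 1"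
      by (subst divide_le_eq_1_pos; linarith)
    then have z1: "z \<le> 1" using z by linarith
    have "exp z \<le> 1 + z + z\<^sup>2" using z0 z1 by (rule exp_bound)
    also have "z\<^sup>2 \<le> z" using z0 z1 by (simp add: power2_eq_square mult_left_le)
    finally show ?thesis using True z by (simp add: z_def[symmetric])
  next
    case False
    have "tent (real J * T x - real j) = 0"
      by (rule tent_eq_0) (use False x J in \<open>auto simp: I_def field_simps\<close>)
    then show ?thesis using diff[OF x] False by simp
  qed
  have "(\<integral>\<^sup>+x. ennreal (exp ((\<nu> x - \<mu> x)\<^sup>2 / \<sigma>\<^sup>2)) \<partial>P)
     \<le> (\<integral>\<^sup>+x. 1 + ennreal (1 / (8 * real J ^ 4)) * indicator I x \<partial>P)"
  proof (intro nn_integral_mono)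
    fix x assume "x \<in> space P"
    from ennreal_leI[OF pt[OF this]]
    show "ennreal (exp ((\<nu> x - \<mu> x)\<^sup>2 / \<sigma>\<^sup>2)) \<le> 1 + ennreal (1 / (8 * real J ^ 4)) * indicator I x"
      by (auto simp: indicator_def split: if_splits)
  qed
  also have "\<dots> = 1 + ennreal (1 / (8 * real J ^ 4)) * emeasure P I"
    by (simp add: nn_integral_add nn_integral_cmult emeasure_space_1)
  also have "\<dots> = ennreal (1 + 1 / (8 * real J ^ 5))"
  proof -
    have "ennreal (1 / (8 * real J ^ 4)) * ennreal (1 / real J) = ennreal (1 / (8 * real J ^ 4) * (1 / real J))"
      by (rule ennreal_mult[symmetric]) auto
    also have "1 / (8 * real J ^ 4) * (1 / real J) = 1 / (8 * real J ^ 5)"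
      using J by (simp add: field_simps eval_nat_numeral)
    finally show ?thesis unfolding eI by (subst ennreal_plus) simp_all
  qed
  also have "\<dots> \<le> ennreal (1 + 1 / (8 * real n))"
  proof (intro ennreal_leI add_left_mono divide_left_mono)
    have "real n \<le> real (J ^ 5)" using n by (simp only: of_nat_le_iff)
    then show "8 * real n \<le> 8 * real J ^ 5" by simp
  qed (use n J in auto)
  finally have "(\<integral>\<^sup>+x. ennreal (exp ((\<nu> x - \<mu> x)\<^sup>2 / \<sigma>\<^sup>2)) \<partial>P) ^ n \<le> ennreal (1 + 1 / (8 * real n)) ^ n"
    by (rule power_mono) simp
  also have "\<dots> = ennreal ((1 + 1 / (8 * real n)) ^ n)"
    by (rule ennreal_power) simp
  also have "(1 + 1 / (8 * real n)) ^ n \<le> exp (1 / (8 * real n)) ^ n"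
    by (intro power_mono) auto
  also have "\<dots> = exp (1 / 8 :: real)"
    using n by (simp add: exp_of_nat_mult[symmetric])
  also have "\<dots> \<le> 1 + 1/8 + (1/8)\<^sup>2" by (rule exp_bound) auto
  also have "\<dots> \<le> (2::real)" by (simp add: power2_eq_square)
  finally show ?thesis by (simp add: ennreal_leI)
qed

text \<open>The share of the j-th cell in the squared loss. Cells are half-open, hence pairwise
  disjoint, so that their shares add up to at most the whole loss.\<close>

definition cell_risk :: "'a measure \<Rightarrow> 'a set \<Rightarrow> ('a \<Rightarrow> real) \<Rightarrow> nat \<Rightarrow> nat \<Rightarrow> ('a \<Rightarrow> real) \<Rightarrow> (real \<Rightarrow> real) \<Rightarrow> ennreal" where
  "cell_risk P S T J j F m =
     (\<integral>\<^sup>+x\<in>{x \<in> S. real J * T x - real j \<in> {0..<1}}. ennreal ((F x - m (T x))\<^sup>2) \<partial>P)"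

lemma cell_risk_cong:
  assumes "\<And>t. real J * t - real j \<in> {0..<1} \<Longrightarrow> m t = m' t"
  shows "cell_risk P S T J j F m = cell_risk P S T J j F m'"
  unfolding cell_risk_def using assms by (intro nn_integral_cong) (auto simp: indicator_def)

text \<open>No \<open>F\<close> is close to both candidates, since (a - b)^2 \<le> 2 a^2 + 2 b^2. On
  the middle half of the cell, which has probability 1/(2 J), the tent is at least 1/8, so the
  squared gap is at least c^2 / (64 J^4).\<close>

lemma two_point_separation:
  assumes P: "prob_space P" and T[measurable]: "T \<in> borel_measurable P"
    and unif: "distr P borel T = uniform_measure lborel {0..1::real}"
    and S[measurable]: "S \<in> sets P" and full: "AE x in P. x \<in> S"
    and F[measurable]: "F \<in> borel_measurable P" and j: "j < J"
  shows "ennreal (c\<^sup>2 / (128 * real J ^ 5))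
    \<le> 2 * cell_risk P S T J j F (perturbed_link c J {}) + 2 * cell_risk P S T J j F (perturbed_link c J {j})"
proof -
  have J: "real J > 0" using j by simp
  define W where "W = {x \<in> space P. T x \<in> {(real j + 1/4) / real J..(real j + 3/4) / real J}}"
  define B where "B = {x \<in> S. real J * T x - real j \<in> {0..<1}}"
  have "B = {x \<in> space P. x \<in> S \<and> real J * T x - real j \<in> {0..<1}}"
    using sets.sets_into_space[OF S] by (auto simp: B_def)
  then have [measurable]: "B \<in> sets P" by simp
  have [measurable]: "W \<in> sets P" unfolding W_def by measurable
  have [measurable]: "perturbed_link c J v \<in> borel_measurable borel" for v
    by (intro borel_measurable_continuous_onI continuous_on_perturbed_link)
  have eW: "emeasure P W = ennreal (1 / (2 * real J))"
    unfolding W_def using j J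
    by (subst emeasure_uniform_interval[OF T unif]) (auto simp: field_simps)
  have pt: "ennreal (c\<^sup>2 / (64 * real J ^ 4)) * indicator W x
     \<le> 2 * (ennreal ((F x - perturbed_link c J {} (T x))\<^sup>2) * indicator B x)
       + 2 * (ennreal ((F x - perturbed_link c J {j} (T x))\<^sup>2) * indicator B x)"
    if xS: "x \<in> S" for x
  proof (cases "x \<in> W")
    case True
    define a b where "a = F x - perturbed_link c J {} (T x)" and "b = F x - perturbed_link c J {j} (T x)"
    have u: "real J * T x - real j \<in> {1/4..3/4}"
      using True J by (auto simp: W_def field_simps)
    then have "x \<in> B" using xS by (auto simp: B_def)
    have "a - b = c / (real J)\<^sup>2 * tent (real J * T x - real j)"
      using perturbed_link_insert[of "{}" J j c "T x"] j by (simp add: a_def b_def)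
    then have ab: "(a - b)\<^sup>2 = c\<^sup>2 / real J ^ 4 * (tent (real J * T x - real j))\<^sup>2"
      by (simp add: power_mult_distrib power_divide)
    have "(1/8)\<^sup>2 \<le> (tent (real J * T x - real j))\<^sup>2"
      by (intro power_mono tent_ge u) simp
    then have "c\<^sup>2 / real J ^ 4 * (1/8)\<^sup>2 \<le> (a - b)\<^sup>2"
      unfolding ab by (intro mult_left_mono) auto
    also have "\<dots> \<le> 2 * a\<^sup>2 + 2 * b\<^sup>2"
      using zero_le_power2[of "a + b"] by (simp add: power2_eq_square algebra_simps)
    finally have "c\<^sup>2 / (64 * real J ^ 4) \<le> 2 * a\<^sup>2 + 2 * b\<^sup>2"
      by (simp add: power2_eq_square)
    from ennreal_leI[OF this] show ?thesis
      using True \<open>x \<in> B\<close> by (simp add: a_def[symmetric] b_def[symmetric] ennreal_plus ennreal_mult)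
  qed simp
  have "ennreal (c\<^sup>2 / (128 * real J ^ 5)) = ennreal (c\<^sup>2 / (64 * real J ^ 4)) * emeasure P W"
  proof -
    have "c\<^sup>2 / (128 * real J ^ 5) = c\<^sup>2 / (64 * real J ^ 4) * (1 / (2 * real J))"
      using J by (simp add: field_simps eval_nat_numeral)
    then show ?thesis unfolding eW by (simp only:) (rule ennreal_mult; simp)
  qed
  also have "\<dots> = (\<integral>\<^sup>+x. ennreal (c\<^sup>2 / (64 * real J ^ 4)) * indicator W x \<partial>P)"
    by (simp add: nn_integral_cmult)
  also have "\<dots> \<le> (\<integral>\<^sup>+x. 2 * (ennreal ((F x - perturbed_link c J {} (T x))\<^sup>2) * indicator B x)
       + 2 * (ennreal ((F x - perturbed_link c J {j} (T x))\<^sup>2) * indicator B x) \<partial>P)"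
    using full by (intro nn_integral_mono_AE) (auto elim!: eventually_mono intro: pt)
  also have "\<dots> = 2 * cell_risk P S T J j F (perturbed_link c J {})
      + 2 * cell_risk P S T J j F (perturbed_link c J {j})"
    unfolding cell_risk_def B_def[symmetric]
    by (simp add: nn_integral_add nn_integral_cmult)
  finally show ?thesis .
qed

text \<open>\<open>E\<close> collects the cells in which the nearer of the two candidates is the
  wrong one. There the true link has the larger of the two risks, so four times its risk exceeds the
  separation bound. The cells are disjoint, so these losses add up.\<close>

lemma test_errors_le_risk:
  fixes c :: real
  assumes P: "prob_space P" and T[measurable]: "T \<in> borel_measurable P"
    and unif: "distr P borel T = uniform_measure lborel {0..1::real}"
    and S[measurable]: "S \<in> sets P" and full: "AE x in P. x \<in> S"
    and F[measurable]: "F \<in> borel_measurable P" and v: "v \<subseteq> {..<J}"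
  defines "E \<equiv> {j \<in> {..<J}. (cell_risk P S T J j F (perturbed_link c J {j})
      \<le> cell_risk P S T J j F (perturbed_link c J {})) \<noteq> (j \<in> v)}"
  shows "of_nat (card E) * ennreal (c\<^sup>2 / (128 * real J ^ 5))
    \<le> 4 * (\<integral>\<^sup>+x\<in>S. ennreal ((F x - perturbed_link c J v (T x))\<^sup>2) \<partial>P)"
proof -
  have [measurable]: "perturbed_link c J v \<in> borel_measurable borel"
    by (intro borel_measurable_continuous_onI continuous_on_perturbed_link)
  define B where "B j = {x \<in> S. real J * T x - real j \<in> {0..<1}}" for j
  have "B j = {x \<in> space P. x \<in> S \<and> real J * T x - real j \<in> {0..<1}}" for j
    using sets.sets_into_space[OF S] by (auto simp: B_def)
  then have [measurable]: "B j \<in> sets P" for j by simp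
  have fin: "finite E" by (simp add: E_def)
  have disj: "disjoint_family_on B E"
    by (force simp: disjoint_family_on_def B_def)
  have cell: "ennreal (c\<^sup>2 / (128 * real J ^ 5)) \<le> 4 * cell_risk P S T J j F (perturbed_link c J v)"
    if j: "j \<in> E" for j
  proof -
    let ?r0 = "cell_risk P S T J j F (perturbed_link c J {})"
    let ?r1 = "cell_risk P S T J j F (perturbed_link c J {j})"
    have "cell_risk P S T J j F (perturbed_link c J v)
        = cell_risk P S T J j F (perturbed_link c J (v \<inter> {j}))"
      by (intro cell_risk_cong perturbed_link_local v) auto
    then have "?r0 \<le> cell_risk P S T J j F (perturbed_link c J v)"
      "?r1 \<le> cell_risk P S T J j F (perturbed_link c J v)"
      using j by (cases "j \<in> v"; auto simp: E_def)+
    then have "2 * ?r0 + 2 * ?r1 \<le> 2 * cell_risk P S T J j F (perturbed_link c J v)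
        + 2 * cell_risk P S T J j F (perturbed_link c J v)"
      by (intro add_mono mult_left_mono) auto
    also have "\<dots> = 4 * cell_risk P S T J j F (perturbed_link c J v)"
      by (simp flip: distrib_right)
    finally show ?thesis
      using two_point_separation[OF P T unif S full F, of j J c] j by (auto simp: E_def intro: order_trans)
  qed
  have "of_nat (card E) * ennreal (c\<^sup>2 / (128 * real J ^ 5))
     \<le> (\<Sum>j\<in>E. 4 * cell_risk P S T J j F (perturbed_link c J v))"
    using cell by (rule sum_bounded_below)
  also have "\<dots> = 4 * (\<integral>\<^sup>+x. ennreal ((F x - perturbed_link c J v (T x))\<^sup>2) * (\<Sum>j\<in>E. indicator (B j) x) \<partial>P)"
    unfolding cell_risk_def B_def[symmetric] sum_distrib_left[symmetric]
    by (simp add: nn_integral_sum sum_distrib_left)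
  also have "\<dots> \<le> 4 * (\<integral>\<^sup>+x\<in>S. ennreal ((F x - perturbed_link c J v (T x))\<^sup>2) \<partial>P)"
  proof (intro mult_left_mono nn_integral_mono)
    fix x
    have "(\<Sum>j\<in>E. indicator (B j) x) = (indicator (\<Union>j\<in>E. B j) x :: ennreal)"
      using fin disj by (rule indicator_UN_disjoint[symmetric])
    also have "\<dots> \<le> indicator S x" by (auto simp: indicator_def B_def)
    finally show "(\<Sum>j\<in>E. indicator (B j) x) \<le> (indicator S x :: ennreal)" .
  qed auto
  finally show ?thesis .
qed

lemma L2_norm_on_ge:
  assumes "0 \<le> r" "ennreal (r\<^sup>2) \<le> (\<integral>\<^sup>+x\<in>A. ennreal ((g x)\<^sup>2) \<partial>P)"
  shows "ennreal r \<le> L2_norm_on P A g"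
proof (cases "(\<integral>\<^sup>+x\<in>A. ennreal ((g x)\<^sup>2) \<partial>P)")
  case (real i)
  then have "r\<^sup>2 \<le> i" using assms by simp
  then have "r \<le> sqrt i" by (rule real_le_rsqrt)
  then show ?thesis using real by (simp add: L2_norm_on_def ennreal_leI)
qed (simp add: L2_norm_on_def)

subsection \<open>The minimax bound\<close>

text \<open>J is n^(1/5) rounded up. Since n \<ge> 1, rounding at most doubles it, whence the factor
  4. The lower bound on J keeps neighbouring links indistinguishable, the upper bound keeps their
  separation large.\<close>

lemma cell_count_bounds:
  assumes "n \<ge> 1"
  obtains J where "0 < J" "n \<le> J ^ 5" "(real J)\<^sup>2 \<le> 4 * real n powr (2/5)"
proof
  define r where "r = real n powr (1/5)"
  have r: "r \<ge> 1" unfolding r_def using assms by (intro ge_one_powr_ge_zero) auto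
  have J: "r \<le> real (nat \<lceil>r\<rceil>)" "real (nat \<lceil>r\<rceil>) \<le> 2 * r" using r by linarith+
  show "0 < nat \<lceil>r\<rceil>" using r by simp
  have "r ^ 5 = real n" unfolding r_def using assms by (simp add: powr_power)
  then have "real n \<le> real (nat \<lceil>r\<rceil>) ^ 5" using power_mono[OF J(1), of 5] r by simp
  then show "n \<le> nat \<lceil>r\<rceil> ^ 5" by (simp only: of_nat_le_iff flip: of_nat_power)
  have "(real (nat \<lceil>r\<rceil>))\<^sup>2 \<le> (2 * r)\<^sup>2" using J r by (intro power_mono) auto
  also have "\<dots> = 4 * real n powr (2/5)" unfolding r_def using assms by (simp add: power_mult_distrib powr_power)
  finally show "(real (nat \<lceil>r\<rceil>))\<^sup>2 \<le> 4 * real n powr (2/5)" .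
qed

text \<open>Independence of the two coordinates says that Q and the product of its marginals agree
  on rectangles, and these determine a sigma-finite product measure.\<close>

lemma independent_pair_law:
  assumes Q: "prob_space Q" and sets: "sets Q = sets (M \<Otimes>\<^sub>M (borel :: real measure))"
    and indep: "prob_space.indep_set Q (sets (vimage_algebra (space Q) fst M))
      (sets (vimage_algebra (space Q) snd borel))"
    and dens: "distributed Q lborel snd f"
  shows "Q = distr Q M fst \<Otimes>\<^sub>M density lborel f"
proof -
  interpret prob_space Q by fact
  have [measurable]: "fst \<in> Q \<rightarrow>\<^sub>M M" "snd \<in> Q \<rightarrow>\<^sub>M borel"
    using measurable_cong_sets[OF sets refl] by auto
  \<comment> \<open>\<open>distributed\<close> speaks of the image measure on \<open>lborel\<close>,
    which is the one on \<open>borel\<close> because an image measure depends only on the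
    sigma-algebra of its target.\<close>
  have N: "distr Q borel snd = density lborel f"
    using distributed_distr_eq_density[OF dens] distr_cong[of Q Q borel lborel snd snd] by simp
  interpret A: prob_space "distr Q M fst" by (rule prob_space_distr) measurable
  interpret B: prob_space "distr Q borel snd" by (rule prob_space_distr) measurable
  have "distr Q M fst \<Otimes>\<^sub>M distr Q borel snd = Q"
  proof (rule pair_measure_eqI[OF A.sigma_finite_measure_axioms B.sigma_finite_measure_axioms])
    show "sets (distr Q M fst \<Otimes>\<^sub>M distr Q borel snd) = sets Q"
      unfolding sets by (intro sets_pair_measure_cong) auto
    fix A B assume A: "A \<in> sets (distr Q M fst)" and B: "B \<in> sets (distr Q borel snd)"
    have "fst -` A \<inter> space Q \<inter> (snd -` B \<inter> space Q) = A \<times> B"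
      using A B sets.sets_into_space[of A M] by (auto simp: sets_eq_imp_space_eq[OF sets] space_pair_measure)
    moreover have "prob (fst -` A \<inter> space Q \<inter> (snd -` B \<inter> space Q))
        = prob (fst -` A \<inter> space Q) * prob (snd -` B \<inter> space Q)"
      using A B by (intro indep_setD[OF indep] in_vimage_algebra) auto
    ultimately show "emeasure (distr Q M fst) A * emeasure (distr Q borel snd) B = emeasure Q (A \<times> B)"
      using A B by (simp add: emeasure_distr emeasure_eq_measure ennreal_mult)
  qed
  then show ?thesis unfolding N by simp
qed

text \<open>The hard link depends on the estimator and is supplied by \<open>assouad\<close>. The
  index is known to be uniform for this \<theta>, so \<theta> stays fixed and only the link moves.
  Here c \<le> L0 keeps the links in the class, and c \<le> \<sigma> keeps them
  indistinguishable.\<close>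

lemma minimax_lower_bound:
  fixes \<sigma> L0 c k :: real and Q :: "((nat \<Rightarrow> real) \<times> real) measure"
  assumes c: "0 < c" "c \<le> L0" "c \<le> \<sigma>" and k: "k < c / 256" and n: "n \<ge> 1"
    and Q: "prob_space Q" and setsQ: "sets Q = sets (vec_space d \<Otimes>\<^sub>M borel)"
    and PX_def: "PX = distr Q (vec_space d) fst" and S_def: "S = support_d d PX"
    and D_def: "D = index_domain d S" and \<theta>: "\<theta> \<in> Theta d"
    and unif: "distr Q borel (\<lambda>(x, e). inner_d d \<theta> x) = uniform_measure lborel {0..1}"
    and law: "Q = PX \<Otimes>\<^sub>M density lborel (normal_density 0 \<sigma>)"
    and f: "f \<in> estimators n d"
  shows "\<exists>m\<in>link_class L0 D. ennreal (1/8) \<le> emeasure (sample_law n d Q m \<theta>)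
         {\<omega> \<in> space (sample_law n d Q m \<theta>).
            ennreal (real n powr (2/5)) * L2_norm_on PX S (\<lambda>x. f \<omega> x - m (inner_d d \<theta> x)) > ennreal k}"
proof -
  interpret Q: prob_space Q by fact
  define T where "T = inner_d d \<theta>"
  have T_vec: "T \<in> borel_measurable (vec_space d)"
    unfolding T_def inner_d_def vec_space_def by measurable
  have setsP: "sets PX = sets (vec_space d)" by (simp add: PX_def)
  have T[measurable]: "T \<in> borel_measurable PX" using T_vec measurable_cong_sets[OF setsP refl] by auto
  have fstQ: "fst \<in> Q \<rightarrow>\<^sub>M vec_space d" using measurable_cong_sets[OF setsQ refl] by auto
  have P: "prob_space PX" unfolding PX_def by (rule Q.prob_space_distr[OF fstQ])
  interpret PX: prob_space PX by (rule P)
  have unifT: "distr PX borel T = uniform_measure lborel {0..1}"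
    unfolding PX_def unif[symmetric]
    by (subst distr_distr[OF T_vec fstQ]) (auto simp: T_def comp_def case_prod_beta')
  have S[measurable]: "S \<in> sets PX" and full: "AE x in PX. x \<in> S"
    unfolding S_def using sets_support_d[OF setsP] AE_support_d[OF setsP] by auto
  have SD: "T x \<in> D" if "x \<in> S" for x
    unfolding D_def index_domain_def T_def using that \<theta> by (intro hull_inc) auto
  have convD: "convex D" unfolding D_def index_domain_def by (rule convex_convex_hull)
  then have Dm[measurable]: "D \<in> sets borel"
    by (intro real_interval_borel_measurable) (simp add: is_interval_convex_1)
  obtain J where J: "0 < J" and nJ: "n \<le> J ^ 5" and J2: "(real J)\<^sup>2 \<le> 4 * real n powr (2/5)"
    using cell_count_bounds[OF n] .
  define g where "g v = perturbed_link c J v" for v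
  have g[measurable]: "g v \<in> borel_measurable borel" for v
    unfolding g_def by (intro borel_measurable_continuous_onI continuous_on_perturbed_link)
  \<comment> \<open>Membership in \<open>link_class\<close> demands the default value outside D. The
    loss is unaffected, since the index of every point of S lies in D.\<close>
  define m where "m v = restrict (g v) D" for v
  have m[measurable]: "m v \<in> borel_measurable borel" for v
    unfolding m_def restrict_def by measurable
  have mg: "m v (T x) = g v (T x)" if "x \<in> S" for v x
    using SD[OF that] by (simp add: m_def)
  have mclass: "m v \<in> link_class L0 D" for v
  proof -
    have "convex_on D (g v)" "c-lipschitz_on D (g v)"
      using c convD by (auto simp: g_def intro!: convex_on_perturbed_link lipschitz_on_perturbed_link)
    then have "convex_on D (m v)"
      using convexD[OF convD] unfolding convex_on_def by (simp add: m_def)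
    moreover have "L0-lipschitz_on D (m v)"
      by (rule lipschitz_on_transform[OF lipschitz_on_le[OF \<open>c-lipschitz_on D (g v)\<close> c(2)]])
         (simp add: m_def)
    ultimately show ?thesis by (auto simp: link_class_def m_def)
  qed
  have sample: "sample_law n d Q (m v) \<theta> = (\<Pi>\<^sub>M i\<in>{..<n}. gaussian_regression PX \<sigma> (\<lambda>x. m v (T x)))" for v
  proof -
    have "distr Q (vec_space d \<Otimes>\<^sub>M borel) (\<lambda>(x, e). (x, m v (T x) + e))
      = distr (PX \<Otimes>\<^sub>M density lborel (normal_density 0 \<sigma>)) (PX \<Otimes>\<^sub>M borel) (\<lambda>(x, e). (x, m v (T x) + e))"
      by (rule distr_cong) (use law setsP in \<open>auto cong: sets_pair_measure_cong\<close>)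
    also have "\<dots> = gaussian_regression PX \<sigma> (\<lambda>x. m v (T x))"
      using c by (intro distr_gaussian_regression PX.sigma_finite_measure_axioms) auto
    finally show ?thesis by (simp add: sample_law_def T_def)
  qed
  define M where "M = (\<Pi>\<^sub>M i\<in>{..<n}. vec_space d \<Otimes>\<^sub>M (borel :: real measure))"
  have setsM: "sets (sample_law n d Q (m v) \<theta>) = sets M" for v
    unfolding sample_law_def M_def by (intro sets_PiM_cong) auto
  note spM = sets_eq_imp_space_eq[OF setsM]
  \<comment> \<open>Joint measurability makes each estimate measurable in x and each cell risk
    measurable in the sample.\<close>
  have f_meas: "case_prod f \<in> borel_measurable (M \<Otimes>\<^sub>M vec_space d)"
    using f by (simp add: estimators_def M_def)
  then have fj[measurable]: "(\<lambda>z. f (fst z) (snd z)) \<in> borel_measurable (M \<Otimes>\<^sub>M PX)"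
    using measurable_cong_sets[OF sets_pair_measure_cong[OF refl setsP] refl]
    by (auto simp: case_prod_beta')
  have fF: "f \<omega> \<in> borel_measurable PX" if "\<omega> \<in> space M" for \<omega>
    using measurable_Pair2[OF fj that] by simp
  \<comment> \<open>The j-th test: decide for membership of j when, on the j-th cell, the estimate
    is at least as close to the link with the split hinge. Ties go to membership.\<close>
  define A where "A j = {\<omega> \<in> space M. cell_risk PX S T J j (f \<omega>) (g {j}) \<le> cell_risk PX S T J j (f \<omega>) (g {})}" for j
  have "(\<lambda>\<omega>. cell_risk PX S T J j (f \<omega>) (g v)) \<in> borel_measurable M" for j v
  proof -
    have "{x \<in> S. real J * T x - real j \<in> {0..<1}} = {x \<in> space PX. x \<in> S \<and> real J * T x - real j \<in> {0..<1}}"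
      using sets.sets_into_space[OF S] by auto
    then have [measurable]: "{x \<in> S. real J * T x - real j \<in> {0..<1}} \<in> sets PX" by simp
    show ?thesis unfolding cell_risk_def
      by (rule PX.borel_measurable_nn_integral) measurable
  qed
  then have A: "A j \<in> sets M" for j unfolding A_def by measurable
  have test: "1/2 \<le> measure (sample_law n d Q (m v) \<theta>) (A j)
      + measure (sample_law n d Q (m (insert j v)) \<theta>) (space M - A j)"
    if j: "j < J" "v \<subseteq> {..<J}" "j \<notin> v" for j v
  proof -
    \<comment> \<open>Outside D both links take the same default value, so the bound holds for every
      x and not only on S.\<close>
    have "\<bar>m (insert j v) (T x) - m v (T x)\<bar> \<le> c / (real J)\<^sup>2 * tent (real J * T x - real j)" for x
      using perturbed_link_insert[OF j(2,1,3), of c "T x"] c tent_nonneg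
      by (auto simp: m_def g_def restrict_def)
    then have "(\<integral>\<^sup>+x. ennreal (exp ((m (insert j v) (T x) - m v (T x))\<^sup>2 / \<sigma>\<^sup>2)) \<partial>PX) ^ n \<le> 2"
      using c j n nJ by (intro tent_chi_square[OF P T unifT, where c=c and j=j and J=J]) auto
    from product_gaussian_testing[OF P _ _ _ this, of "A j"] show ?thesis
      unfolding sample[symmetric] spM setsM using c A by auto
  qed
  have "prob_space (sample_law n d Q (m v) \<theta>)" for v
    unfolding sample using c by (intro prob_space_PiM prob_space_gaussian_regression P) auto
  from assouad[OF J this setsM A test] obtain v where v: "v \<subseteq> {..<J}"
    and G: "1/8 \<le> measure (sample_law n d Q (m v) \<theta>)
      {\<omega> \<in> space M. real J / 8 \<le> real (card {j \<in> {..<J}. (\<omega> \<in> A j) \<noteq> (j \<in> v)})}" by blast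
  define I where "I \<omega> = (\<integral>\<^sup>+x\<in>S. ennreal ((f \<omega> x - m v (inner_d d \<theta> x))\<^sup>2) \<partial>PX)" for \<omega>
  define Ev where "Ev = {\<omega> \<in> space M. ennreal (real n powr (2/5))
     * L2_norm_on PX S (\<lambda>x. f \<omega> x - m v (inner_d d \<theta> x)) > ennreal k}"
  have [measurable]: "I \<in> borel_measurable M"
    unfolding I_def T_def[symmetric] by (rule PX.borel_measurable_nn_integral) measurable
  have "(\<lambda>\<omega>. L2_norm_on PX S (\<lambda>x. f \<omega> x - m v (inner_d d \<theta> x))) \<in> borel_measurable M"
    unfolding L2_norm_on_def Let_def I_def[symmetric] by measurable
  then have Ev: "Ev \<in> sets M" unfolding Ev_def by measurable
  have sub: "{\<omega> \<in> space M. real J / 8 \<le> real (card {j \<in> {..<J}. (\<omega> \<in> A j) \<noteq> (j \<in> v)})} \<subseteq> Ev"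
  proof safe
    fix \<omega> assume \<omega>: "\<omega> \<in> space M"
      and N: "real J / 8 \<le> real (card {j \<in> {..<J}. (\<omega> \<in> A j) \<noteq> (j \<in> v)})"
    \<comment> \<open>Chosen so that 4 r^2 = (J/8) * c^2 / (128 J^5), the bound that J/8 wrong tests
      give for four times the squared loss.\<close>
    define r where "r = c / (64 * (real J)\<^sup>2)"
    have I_eq: "I \<omega> = (\<integral>\<^sup>+x\<in>S. ennreal ((f \<omega> x - g v (T x))\<^sup>2) \<partial>PX)"
      unfolding I_def by (intro nn_integral_cong) (auto simp: indicator_def mg T_def[symmetric])
    have E: "{j \<in> {..<J}. (\<omega> \<in> A j) \<noteq> (j \<in> v)} = {j \<in> {..<J}.
       (cell_risk PX S T J j (f \<omega>) (g {j}) \<le> cell_risk PX S T J j (f \<omega>) (g {})) \<noteq> (j \<in> v)}"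
      using \<omega> by (auto simp: A_def)
    have "4 * ennreal (r\<^sup>2) = ennreal (4 * r\<^sup>2)"
      unfolding ennreal_numeral[symmetric] by (rule ennreal_mult[symmetric]) auto
    also have "4 * r\<^sup>2 = c\<^sup>2 / (1024 * real J ^ 4)"
      by (simp add: r_def power_divide power_mult_distrib)
    also have "\<dots> = real J / 8 * (c\<^sup>2 / (128 * real J ^ 5))"
      using J by (simp add: power_Suc2[of "real J" 4, simplified])
    also have "\<dots> \<le> ennreal (real (card {j \<in> {..<J}. (\<omega> \<in> A j) \<noteq> (j \<in> v)}) * (c\<^sup>2 / (128 * real J ^ 5)))"
      using N by (intro ennreal_leI mult_right_mono) auto
    also have "\<dots> = of_nat (card {j \<in> {..<J}. (\<omega> \<in> A j) \<noteq> (j \<in> v)}) * ennreal (c\<^sup>2 / (128 * real J ^ 5))"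
      by (subst ennreal_mult) (simp_all only: ennreal_of_nat_eq_real_of_nat, simp_all)
    also have "\<dots> \<le> 4 * I \<omega>"
      unfolding I_eq E unfolding g_def by (rule test_errors_le_risk[OF P T unifT S full fF[OF \<omega>] v])
    finally have "ennreal (r\<^sup>2) \<le> I \<omega>"
      by (subst (asm) ennreal_mult_le_mult_iff) auto
    then have L2: "ennreal r \<le> L2_norm_on PX S (\<lambda>x. f \<omega> x - m v (inner_d d \<theta> x))"
      unfolding I_def using c by (intro L2_norm_on_ge) (auto simp: r_def)
    \<comment> \<open>From J^2 \<le> 4 n^(2/5), the definition of r gives r \<ge> c / (256 n^(2/5)).
      This is the source of the constant 256.\<close>
    have "c / 256 \<le> real n powr (2/5) * r"
      using mult_left_mono[OF J2, of c] c J by (simp add: r_def field_simps)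
    then have "ennreal k < ennreal (real n powr (2/5) * r)"
      using k c by (intro ennreal_lessI) (auto intro: less_le_trans[of 0 "c/256"])
    also have "\<dots> = ennreal (real n powr (2/5)) * ennreal r"
      using c by (intro ennreal_mult) (auto simp: r_def)
    also have "\<dots> \<le> ennreal (real n powr (2/5)) * L2_norm_on PX S (\<lambda>x. f \<omega> x - m v (inner_d d \<theta> x))"
      using L2 by (rule mult_left_mono) simp
    finally show "\<omega> \<in> Ev" using \<omega> by (simp add: Ev_def)
  qed
  interpret SL: prob_space "sample_law n d Q (m v) \<theta>" by fact
  have "1/8 \<le> SL.prob Ev"
    using G SL.finite_measure_mono[OF sub] Ev setsM by (auto intro: order_trans)
  then have "ennreal (1/8) \<le> emeasure (sample_law n d Q (m v) \<theta>) Ev"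
    unfolding SL.emeasure_eq_measure by (rule ennreal_leI)
  then show ?thesis
    using mclass[of v] unfolding Ev_def spM[symmetric, of v] by blast
qed

theorem propositionS6p1:
  fixes \<sigma> L0 :: real
  assumes "\<sigma> > 0" and "L0 > 0"
  shows "\<exists>k1>0. \<exists>k2>0. \<forall>(n::nat) (d::nat) (Q :: ((nat \<Rightarrow> real) \<times> real) measure)
      (M0::real) (T::real) (q::real) (m0 :: real \<Rightarrow> real) (\<theta>0 :: nat \<Rightarrow> real) PX S D \<F>.
    n \<ge> 1 \<longrightarrow> d \<ge> 1 \<longrightarrow>
    prob_space Q \<longrightarrow> sets Q = sets (vec_space d \<Otimes>\<^sub>M borel) \<longrightarrow>
    PX = distr Q (vec_space d) fst \<longrightarrow>
    S = support_d d PX \<longrightarrow>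
    D = index_domain d S \<longrightarrow>
    \<F> = vimage_algebra (space Q) fst (vec_space d) \<longrightarrow>
    m0 \<in> link_class L0 D \<longrightarrow> \<theta>0 \<in> Theta d \<longrightarrow>
    M0 \<ge> 1 \<longrightarrow> (\<forall>t\<in>D. \<bar>m0 t\<bar> \<le> M0) \<longrightarrow>
    (\<forall>x\<in>S. norm_d d x \<le> T) \<longrightarrow>
    q \<ge> 2 \<longrightarrow> integrable Q (\<lambda>(x, e). \<bar>e\<bar> powr q) \<longrightarrow>
    (AE \<omega> in Q. real_cond_exp Q \<F> snd \<omega> = 0) \<longrightarrow>
    (AE \<omega> in Q. real_cond_exp Q \<F> (\<lambda>(x, e). e\<^sup>2) \<omega> \<le> \<sigma>\<^sup>2) \<longrightarrow>
    distr Q borel (\<lambda>(x, e). inner_d d \<theta>0 x) = uniform_measure lborel {0..1} \<longrightarrow>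
    prob_space.indep_set Q (sets \<F>) (sets (vimage_algebra (space Q) snd borel)) \<longrightarrow>
    distributed Q lborel snd (normal_density 0 \<sigma>) \<longrightarrow>
    (INF f\<in>estimators n d. SUP (m, \<theta>)\<in>link_class L0 D \<times> Theta d.
       emeasure (sample_law n d Q m \<theta>)
         {\<omega> \<in> space (sample_law n d Q m \<theta>).
            ennreal (real n powr (2/5)) * L2_norm_on PX S (\<lambda>x. f \<omega> x - m (inner_d d \<theta> x))
              > ennreal k1})
    \<ge> ennreal k2"
proof -
  \<comment> \<open>The amplitude respects both the Lipschitz bound and the noise level, and depends
    on nothing else.\<close>
  define c where "c = min L0 \<sigma>"
  have c: "0 < c" "c \<le> L0" "c \<le> \<sigma>" using assms by (auto simp: c_def)
  show ?thesis
  \<comment> \<open>Half of c/256 gives the strict inequality for k; 1/8 is the probability from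
    \<open>assouad\<close>.\<close>
  proof (rule exI[of _ "c / 512"], rule conjI[rotated], rule exI[of _ "1/8"],
      intro conjI allI impI INF_greatest)
    fix n d :: nat and Q :: "((nat \<Rightarrow> real) \<times> real) measure" and \<theta>0 PX S D \<F> f
    assume n: "n \<ge> 1" and Q: "prob_space Q" and setsQ: "sets Q = sets (vec_space d \<Otimes>\<^sub>M borel)"
      and PX: "PX = distr Q (vec_space d) fst" and S: "S = support_d d PX"
      and D: "D = index_domain d S" and \<F>: "\<F> = vimage_algebra (space Q) fst (vec_space d)"
      and \<theta>: "\<theta>0 \<in> Theta d"
      and unif: "distr Q borel (\<lambda>(x, e). inner_d d \<theta>0 x) = uniform_measure lborel {0..1}"
      and indep: "prob_space.indep_set Q (sets \<F>) (sets (vimage_algebra (space Q) snd borel))"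
      and dens: "distributed Q lborel snd (normal_density 0 \<sigma>)"
      and f: "f \<in> estimators n d"
    have "Q = PX \<Otimes>\<^sub>M density lborel (normal_density 0 \<sigma>)"
      unfolding PX using independent_pair_law[OF Q setsQ _ dens] indep \<F> by blast
    from minimax_lower_bound[OF c _ n Q setsQ PX S D \<theta> unif this f, of "c / 512"] c
    obtain m where "m \<in> link_class L0 D" "ennreal (1/8) \<le> emeasure (sample_law n d Q m \<theta>0)
         {\<omega> \<in> space (sample_law n d Q m \<theta>0). ennreal (real n powr (2/5))
            * L2_norm_on PX S (\<lambda>x. f \<omega> x - m (inner_d d \<theta>0 x)) > ennreal (c / 512)}"
      by auto
    then show "ennreal (1/8) \<le> (SUP (m, \<theta>)\<in>link_class L0 D \<times> Theta d.
       emeasure (sample_law n d Q m \<theta>)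
         {\<omega> \<in> space (sample_law n d Q m \<theta>).
            ennreal (real n powr (2/5)) * L2_norm_on PX S (\<lambda>x. f \<omega> x - m (inner_d d \<theta> x))
              > ennreal (c / 512)})"
      using \<theta> by (intro SUP_upper2[of "(m, \<theta>0)"]) auto
  qed (use c in auto)
qed

end
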